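(* A ring $R$ is strongly $\Delta$-clean with $J(R)=(0)$ if and only if $R$ is boolean.
   Context: Rings are associative with identity, not necessarily commutative. $U(R)$ is the group of units and $J(R)$ the Jacobson radical of $R$. Define $\Delta(R)=\{x\in R \mid 1-xu\in U(R)\text{ for all }u\in U(R)\}$. A ring $R$ is strongly $\Delta$-clean if every $a\in R$ can be written $a=e+d$ with $e^2=e\in R$, $d\in\Delta(R)$ and $ed=de$. A ring is boolean if $a^2=a$ for all its elements $a$. *)

theory Defs
  imports "HOL-Algebra.Ideal"
begin

text \<open>Neither commutativity nor \<open>\<one> \<noteq> \<zero>\<close> is assumed. The library's \<^locale>\<open>ideal\<close> and
  \<^locale>\<open>maximalideal\<close> are two-sided, so the one-sided versions needed for the Jacobson
  radical of a noncommutative ring are defined here.\<close>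

locale left_ideal = additive_subgroup I R + ring R for I and R (structure) +
  assumes l_mult_closed: "\<lbrakk>a \<in> I; x \<in> carrier R\<rbrakk> \<Longrightarrow> x \<otimes> a \<in> I"

definition maximal_left_ideal :: "'a set \<Rightarrow> ('a, 'b) ring_scheme \<Rightarrow> bool"
  where "maximal_left_ideal M R \<longleftrightarrow>
    left_ideal M R \<and> M \<noteq> carrier R \<and>
    (\<forall>I. left_ideal I R \<and> M \<subseteq> I \<longrightarrow> I = M \<or> I = carrier R)"

text \<open>Membership in the carrier is required explicitly because the zero ring has no maximal
  left ideals: there the radical is the whole (one-element) ring.\<close>

definition jacobson_radical :: "('a, 'b) ring_scheme \<Rightarrow> 'a set"
  where "jacobson_radical R = {x \<in> carrier R. \<forall>M. maximal_left_ideal M R \<longrightarrow> x \<in> M}"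

definition Delta :: "('a, 'b) ring_scheme \<Rightarrow> 'a set"
  where "Delta R = {x \<in> carrier R. \<forall>u \<in> Units R. \<one>\<^bsub>R\<^esub> \<ominus>\<^bsub>R\<^esub> x \<otimes>\<^bsub>R\<^esub> u \<in> Units R}"

definition strongly_Delta_clean :: "('a, 'b) ring_scheme \<Rightarrow> bool"
  where "strongly_Delta_clean R \<longleftrightarrow>
    (\<forall>a \<in> carrier R. \<exists>e \<in> carrier R. \<exists>d \<in> Delta R.
       a = e \<oplus>\<^bsub>R\<^esub> d \<and> e \<otimes>\<^bsub>R\<^esub> e = e \<and> e \<otimes>\<^bsub>R\<^esub> d = d \<otimes>\<^bsub>R\<^esub> e)"

definition boolean :: "('a, 'b) ring_scheme \<Rightarrow> bool"
  where "boolean R \<longleftrightarrow> (\<forall>a \<in> carrier R. a \<otimes>\<^bsub>R\<^esub> a = a)"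

end

theory Submission
  imports Defs
begin

text \<open>In a strongly \<open>\<Delta>\<close>-clean ring, decomposing a unit as \<open>u = e + d\<close> makes \<open>e = u - d\<close> an
  invertible idempotent, so \<open>u - 1 \<in> \<Delta>\<close>. Thus \<open>\<Delta>\<close> consists of exactly those \<open>x\<close> with \<open>1 + x\<close>
  invertible. This forces \<open>e d \<in> \<Delta>\<close> for every idempotent \<open>e\<close> and every \<open>d \<in> \<Delta>\<close>: with
  \<open>f = 1 - e\<close>, removing the square-zero Peirce components \<open>e d f\<close> and \<open>f d e\<close> from \<open>d\<close>
  leaves an element of \<open>\<Delta>\<close> commuting with \<open>e\<close>, so \<open>1 + e d e\<close> is invertible, and
  \<open>1 + e d = (1 + e d f) (1 + e d e)\<close>. As every element is a sum of an idempotent and an element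
  of \<open>\<Delta>\<close>, the set \<open>\<Delta>\<close> is a left ideal, hence lies in the Jacobson radical. If the radical
  vanishes, every element is idempotent. Conversely, in a boolean ring the left invertibility of
  \<open>1 - x\<close> and \<open>(1 - x) x = 0\<close> give \<open>x = 0\<close>, so the radical vanishes.\<close>

context ring
begin

subsection \<open>Left ideals\<close>

text \<open>Negatives come for free: \<open>\<ominus> a\<close> is the left multiple of
  \<open>a\<close> by \<open>\<ominus> \<one>\<close>, so sums, zero and left multiples
  suffice.\<close>

lemma left_idealI:
  assumes "I \<subseteq> carrier R" "\<zero> \<in> I"
    and "\<And>a b. \<lbrakk>a \<in> I; b \<in> I\<rbrakk> \<Longrightarrow> a \<oplus> b \<in> I"
    and mult: "\<And>a x. \<lbrakk>a \<in> I; x \<in> carrier R\<rbrakk> \<Longrightarrow> x \<otimes> a \<in> I"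
  shows "left_ideal I R"
proof -
  have "\<ominus> a \<in> I" if "a \<in> I" for a
    using mult[OF that, of "\<ominus> \<one>"] that assms(1) by (auto simp: l_minus)
  then have "subgroup I (add_monoid R)"
    using assms by (intro subgroup.intro) (auto simp: a_inv_def)
  then show ?thesis
    using mult by (intro left_ideal.intro additive_subgroup.intro left_ideal_axioms.intro ring_axioms)
qed

lemma left_ideal_subset: "left_ideal I R \<Longrightarrow> I \<subseteq> carrier R"
  by (simp add: left_ideal_def additive_subgroup.a_subset)

lemma left_ideal_zero: "left_ideal I R \<Longrightarrow> \<zero> \<in> I"
  by (simp add: left_ideal_def additive_subgroup.zero_closed)

lemma left_ideal_add: "\<lbrakk>left_ideal I R; a \<in> I; b \<in> I\<rbrakk> \<Longrightarrow> a \<oplus> b \<in> I"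
  by (simp add: left_ideal_def additive_subgroup.a_closed)

lemma left_ideal_eq_carrier:
  assumes "left_ideal I R" "\<one> \<in> I"
  shows "I = carrier R"
  using left_ideal.l_mult_closed[OF assms] left_ideal_subset[OF assms(1)] by auto

text \<open>The sum \<open>I + R x\<close>, the least left ideal containing \<open>I\<close> and
  \<open>x\<close>; maximality is tested against it.\<close>

lemma left_ideal_adjoin:
  assumes "left_ideal I R" "x \<in> carrier R"
  shows "left_ideal {a \<oplus> r \<otimes> x | a r. a \<in> I \<and> r \<in> carrier R} R"
proof (rule left_idealI)
  note I = left_ideal_subset[OF assms(1)]
  show "{a \<oplus> r \<otimes> x | a r. a \<in> I \<and> r \<in> carrier R} \<subseteq> carrier R"
    using I assms by auto
  have "\<zero> = \<zero> \<oplus> \<zero> \<otimes> x"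
    using assms by simp
  then show "\<zero> \<in> {a \<oplus> r \<otimes> x | a r. a \<in> I \<and> r \<in> carrier R}"
    using left_ideal_zero[OF assms(1)] by blast
next
  fix p q
  assume "p \<in> {a \<oplus> r \<otimes> x | a r. a \<in> I \<and> r \<in> carrier R}"
    "q \<in> {a \<oplus> r \<otimes> x | a r. a \<in> I \<and> r \<in> carrier R}"
  then obtain a r b s where *: "p = a \<oplus> r \<otimes> x" "q = b \<oplus> s \<otimes> x"
    "a \<in> I" "b \<in> I" "r \<in> carrier R" "s \<in> carrier R"
    by blast
  then have "a \<in> carrier R" "b \<in> carrier R"
    using left_ideal_subset[OF assms(1)] by auto
  then have "p \<oplus> q = (a \<oplus> b) \<oplus> (r \<oplus> s) \<otimes> x"
    using * assms(2) by algebra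
  then show "p \<oplus> q \<in> {a \<oplus> r \<otimes> x | a r. a \<in> I \<and> r \<in> carrier R}"
    using * left_ideal_add[OF assms(1)] by blast
next
  fix p y
  assume "p \<in> {a \<oplus> r \<otimes> x | a r. a \<in> I \<and> r \<in> carrier R}" and y: "y \<in> carrier R"
  then obtain a r where *: "p = a \<oplus> r \<otimes> x" "a \<in> I" "r \<in> carrier R"
    by blast
  then have "a \<in> carrier R"
    using left_ideal_subset[OF assms(1)] by auto
  then have "y \<otimes> p = y \<otimes> a \<oplus> (y \<otimes> r) \<otimes> x"
    using * y assms(2) by algebra
  then show "y \<otimes> p \<in> {a \<oplus> r \<otimes> x | a r. a \<in> I \<and> r \<in> carrier R}"
    using * y left_ideal.l_mult_closed[OF assms(1)] by blast
qed

lemma left_ideal_principal: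
  assumes "x \<in> carrier R"
  shows "left_ideal {r \<otimes> x | r. r \<in> carrier R} R"
proof -
  have "left_ideal {\<zero>} R"
    by (rule left_idealI) auto
  moreover have "{a \<oplus> r \<otimes> x | a r. a \<in> {\<zero>} \<and> r \<in> carrier R} = {r \<otimes> x | r. r \<in> carrier R}"
    using assms by force
  ultimately show ?thesis
    using left_ideal_adjoin[of "{\<zero>}" x] assms by simp
qed

lemma left_ideal_Union_chain:
  assumes "subset.chain {I. left_ideal I R} C" "C \<noteq> {}"
  shows "left_ideal (\<Union>C) R"
proof (rule left_idealI)
  have C: "left_ideal I R" if "I \<in> C" for I
    using assms that by (auto simp: subset.chain_def)
  show "\<Union>C \<subseteq> carrier R" "\<zero> \<in> \<Union>C"
    using C left_ideal_subset left_ideal_zero assms(2) by blast+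
  show "x \<otimes> a \<in> \<Union>C" if "a \<in> \<Union>C" "x \<in> carrier R" for a x
    using C left_ideal.l_mult_closed that by fast
  fix a b assume "a \<in> \<Union>C" "b \<in> \<Union>C"
  then obtain I J where "I \<in> C" "J \<in> C" "a \<in> I" "b \<in> J"
    by blast
  \<comment> \<open>Two members of a chain are comparable, so both summands lie in the larger
    one.\<close>
  moreover have "I \<subseteq> J \<or> J \<subseteq> I"
    using assms(1) \<open>I \<in> C\<close> \<open>J \<in> C\<close> by (auto simp: subset_chain_def)
  ultimately show "a \<oplus> b \<in> \<Union>C"
    using C left_ideal_add by blast
qed

text \<open>Zorn's lemma on the left ideals above \<open>I\<close> that avoid \<open>\<one>\<close>.
  Avoiding \<open>\<one>\<close> is the same as being proper, and it visibly passes to unions of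
  chains.\<close>

lemma ex_maximal_left_ideal:
  assumes "left_ideal I R" "\<one> \<notin> I"
  obtains M where "maximal_left_ideal M R" "I \<subseteq> M"
proof -
  let ?A = "{J. left_ideal J R \<and> \<one> \<notin> J \<and> I \<subseteq> J}"
  have "\<exists>M\<in>?A. \<forall>J\<in>?A. M \<subseteq> J \<longrightarrow> J = M"
  proof (rule subset_Zorn_nonempty)
    show "?A \<noteq> {}"
      using assms by blast
    fix C assume C: "C \<noteq> {}" "subset.chain ?A C"
    then have "subset.chain {I. left_ideal I R} C"
      by (auto simp: subset_chain_def)
    then have "left_ideal (\<Union>C) R"
      using C(1) by (rule left_ideal_Union_chain)
    moreover have "\<one> \<notin> \<Union>C" "I \<subseteq> \<Union>C"
      using C unfolding subset_chain_def by blast+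
    ultimately show "\<Union>C \<in> ?A"
      by blast
  qed
  then obtain M where M: "M \<in> ?A" and max: "\<forall>J\<in>?A. M \<subseteq> J \<longrightarrow> J = M" ..
  have "J = M \<or> J = carrier R" if J: "left_ideal J R" "M \<subseteq> J" for J
  proof (cases "\<one> \<in> J")
    case True
    then show ?thesis
      using left_ideal_eq_carrier J(1) by simp
  next
    case False
    then have "J \<in> ?A"
      using J M by auto
    then show ?thesis
      using max J(2) by simp
  qed
  moreover have "M \<noteq> carrier R"
    using M by auto
  ultimately have "maximal_left_ideal M R"
    using M by (simp add: maximal_left_ideal_def)
  then show thesis
    using M that by simp
qed

section \<open>The Jacobson radical and invertibility\<close>

lemma jacobson_radicalI:
  assumes x: "x \<in> carrier R"
    and unit: "\<And>r. r \<in> carrier R \<Longrightarrow> \<one> \<ominus> r \<otimes> x \<in> Units R"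
  shows "x \<in> jacobson_radical R"
proof -
  have "x \<in> M" if M: "maximal_left_ideal M R" for M
  proof (rule ccontr)
    assume "x \<notin> M"
    have MI: "left_ideal M R" "M \<noteq> carrier R"
      using M by (auto simp: maximal_left_ideal_def)
    note sub = left_ideal_subset[OF MI(1)]
    \<comment> \<open>\<open>M + R x\<close> is strictly larger than \<open>M\<close>, hence the
      whole ring. Writing \<open>\<one> = m \<oplus> r \<otimes> x\<close> then exhibits
      \<open>m = \<one> \<ominus> r \<otimes> x\<close> as a unit inside the proper left ideal
      \<open>M\<close>.\<close>
    let ?I = "{a \<oplus> r \<otimes> x | a r. a \<in> M \<and> r \<in> carrier R}"
    have "left_ideal ?I R"
      using left_ideal_adjoin[OF MI(1) x] .
    moreover have "a \<in> ?I" if "a \<in> M" for a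
    proof -
      have "a = a \<oplus> \<zero> \<otimes> x"
        using that sub x by auto
      then show ?thesis
        using that by blast
    qed
    moreover have "x \<in> ?I"
    proof -
      have "x = \<zero> \<oplus> \<one> \<otimes> x"
        using x by simp
      then show ?thesis
        using left_ideal_zero[OF MI(1)] by blast
    qed
    ultimately have "?I = carrier R"
      using M \<open>x \<notin> M\<close> unfolding maximal_left_ideal_def by blast
    then have "\<one> \<in> ?I"
      by simp
    then obtain m r where mr: "\<one> = m \<oplus> r \<otimes> x" "m \<in> M" "r \<in> carrier R"
      by blast
    have "m \<in> carrier R"
      using mr sub by blast
    then have "m = \<one> \<ominus> r \<otimes> x"
      unfolding mr(1) using mr(3) x by algebra
    then have "m \<in> Units R"
      using unit mr(3) by simp
    then have "\<one> \<in> M"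
      using left_ideal.l_mult_closed[OF MI(1) mr(2), of "inv m"] by simp
    then show False
      using left_ideal_eq_carrier MI by blast
  qed
  then show ?thesis
    using x by (simp add: jacobson_radical_def)
qed

text \<open>If \<open>R (\<one> \<ominus> x)\<close> were proper, some maximal left ideal would
  contain \<open>\<one> \<ominus> x\<close> as well as \<open>x\<close>, and so their sum
  \<open>\<one>\<close>.\<close>

lemma jacobson_radical_left_inverse:
  assumes "x \<in> jacobson_radical R"
  obtains y where "y \<in> carrier R" "y \<otimes> (\<one> \<ominus> x) = \<one>"
proof -
  have x: "x \<in> carrier R"
    using assms by (simp add: jacobson_radical_def)
  let ?I = "{r \<otimes> (\<one> \<ominus> x) | r. r \<in> carrier R}"
  have "\<one> \<in> ?I"
  proof (rule ccontr)
    assume "\<one> \<notin> ?I"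
    have "left_ideal ?I R"
      using x by (intro left_ideal_principal) simp
    then obtain M where M: "maximal_left_ideal M R" "?I \<subseteq> M"
      using \<open>\<one> \<notin> ?I\<close> by (rule ex_maximal_left_ideal)
    have MI: "left_ideal M R" "M \<noteq> carrier R"
      using M by (auto simp: maximal_left_ideal_def)
    have "\<one> \<ominus> x = \<one> \<otimes> (\<one> \<ominus> x)"
      using x by simp
    then have "\<one> \<ominus> x \<in> M"
      using M(2) by blast
    moreover have "x \<in> M"
      using assms M(1) by (simp add: jacobson_radical_def)
    moreover have "\<one> = (\<one> \<ominus> x) \<oplus> x"
      using x by algebra
    ultimately have "\<one> \<in> M"
      using left_ideal_add[OF MI(1)] by metis
    then show False
      using left_ideal_eq_carrier MI by blast
  qed
  then show thesis
    using that by auto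
qed

lemma zero_in_jacobson_radical: "\<zero> \<in> jacobson_radical R"
  by (auto simp: jacobson_radical_def maximal_left_ideal_def left_ideal_zero)

lemma boolean_jacobson_radical:
  assumes "boolean R"
  shows "jacobson_radical R = {\<zero>}"
proof -
  have "x = \<zero>" if xJ: "x \<in> jacobson_radical R" for x
  proof -
    obtain y where y: "y \<in> carrier R" "y \<otimes> (\<one> \<ominus> x) = \<one>"
      using xJ by (rule jacobson_radical_left_inverse)
    have x: "x \<in> carrier R" "x \<otimes> x = x"
      using xJ assms by (auto simp: jacobson_radical_def boolean_def)
    have "x = y \<otimes> (\<one> \<ominus> x) \<otimes> x"
      using x y by simp
    also have "\<dots> = y \<otimes> (x \<ominus> x \<otimes> x)"
      using x(1) y(1) by algebra
    also have "\<dots> = \<zero>"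
      using x y(1) by (simp add: r_neg minus_eq)
    finally show ?thesis .
  qed
  then show ?thesis
    using zero_in_jacobson_radical by blast
qed

subsection \<open>The set \<open>\<Delta>\<close>\<close>

lemma Units_uminus: "u \<in> Units R \<Longrightarrow> \<ominus> u \<in> Units R"
  using Units_minus_one_closed Units_m_closed[of "\<ominus> \<one>" u]
  by (simp add: l_minus Units_closed)

text \<open>Multiplying \<open>\<one> \<ominus> x \<otimes> inv u\<close> on the right by
  \<open>u\<close> gives \<open>u \<ominus> x\<close>. Thus \<open>Delta R\<close> consists of the
  elements whose subtraction keeps units invertible, which makes its additive closure
  immediate.\<close>

lemma Delta_iff: "x \<in> Delta R \<longleftrightarrow> x \<in> carrier R \<and> (\<forall>u\<in>Units R. u \<ominus> x \<in> Units R)"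
proof (intro iffI conjI ballI)
  assume x: "x \<in> Delta R"
  then show "x \<in> carrier R"
    by (simp add: Delta_def)
  fix u assume u: "u \<in> Units R"
  then have "\<one> \<ominus> x \<otimes> inv u \<in> Units R"
    using x by (simp add: Delta_def)
  then have "(\<one> \<ominus> x \<otimes> inv u) \<otimes> u \<in> Units R"
    using u by simp
  also have "(\<one> \<ominus> x \<otimes> inv u) \<otimes> u = u \<ominus> x \<otimes> (inv u \<otimes> u)"
    using u \<open>x \<in> carrier R\<close> Units_inv_closed[OF u] Units_closed[OF u] by algebra
  finally show "u \<ominus> x \<in> Units R"
    using u \<open>x \<in> carrier R\<close> by simp
next
  assume x: "x \<in> carrier R \<and> (\<forall>u\<in>Units R. u \<ominus> x \<in> Units R)"
  have "\<one> \<ominus> x \<otimes> u \<in> Units R" if u: "u \<in> Units R" for u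
  proof -
    have "(inv u \<ominus> x) \<otimes> u \<in> Units R"
      using x u by simp
    also have "(inv u \<ominus> x) \<otimes> u = inv u \<otimes> u \<ominus> x \<otimes> u"
      using x Units_inv_closed[OF u] Units_closed[OF u] by algebra
    finally show ?thesis
      using u by simp
  qed
  then show "x \<in> Delta R"
    using x by (simp add: Delta_def)
qed

lemma Delta_closed: "x \<in> Delta R \<Longrightarrow> x \<in> carrier R"
  by (simp add: Delta_def)

lemma Delta_Units_minus: "\<lbrakk>x \<in> Delta R; u \<in> Units R\<rbrakk> \<Longrightarrow> u \<ominus> x \<in> Units R"
  by (simp add: Delta_iff)

lemma zero_in_Delta: "\<zero> \<in> Delta R"
  by (simp add: Delta_iff minus_eq Units_closed)

lemma Delta_uminus:
  assumes "x \<in> Delta R"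
  shows "\<ominus> x \<in> Delta R"
  unfolding Delta_iff
proof (intro conjI ballI)
  note x = Delta_closed[OF assms]
  then show "\<ominus> x \<in> carrier R"
    by simp
  fix u assume u: "u \<in> Units R"
  have "\<ominus> (\<ominus> u \<ominus> x) \<in> Units R"
    using assms u by (intro Units_uminus Delta_Units_minus)
  also have "\<ominus> (\<ominus> u \<ominus> x) = u \<ominus> (\<ominus> x)"
    using x Units_closed[OF u] by algebra
  finally show "u \<ominus> (\<ominus> x) \<in> Units R" .
qed

lemma Delta_add:
  assumes "x \<in> Delta R" "y \<in> Delta R"
  shows "x \<oplus> y \<in> Delta R"
  unfolding Delta_iff
proof (intro conjI ballI)
  note xy = assms[THEN Delta_closed]
  then show "x \<oplus> y \<in> carrier R"
    by simp
  fix u assume u: "u \<in> Units R"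
  have "(u \<ominus> x) \<ominus> y \<in> Units R"
    using assms u by (intro Delta_Units_minus)
  also have "(u \<ominus> x) \<ominus> y = u \<ominus> (x \<oplus> y)"
    using xy Units_closed[OF u] by algebra
  finally show "u \<ominus> (x \<oplus> y) \<in> Units R" .
qed

lemma Delta_minus: "\<lbrakk>x \<in> Delta R; y \<in> Delta R\<rbrakk> \<Longrightarrow> x \<ominus> y \<in> Delta R"
  by (simp add: minus_eq Delta_add Delta_uminus)

lemma Delta_Units_add: "\<lbrakk>x \<in> Delta R; u \<in> Units R\<rbrakk> \<Longrightarrow> u \<oplus> x \<in> Units R"
  using Delta_Units_minus[OF Delta_uminus, of x u] by (simp add: minus_eq Delta_closed)

lemma Delta_Units_mult:
  assumes "v \<in> Units R" "x \<in> Delta R"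
  shows "v \<otimes> x \<in> Delta R"
  unfolding Delta_iff
proof (intro conjI ballI)
  note cl = Units_closed[OF assms(1)] Units_inv_closed[OF assms(1)] Delta_closed[OF assms(2)]
  then show "v \<otimes> x \<in> carrier R"
    by simp
  fix u assume u: "u \<in> Units R"
  \<comment> \<open>Factoring out \<open>v\<close> moves the question to the unit
    \<open>inv v \<otimes> u\<close>, from which \<open>x\<close> may be subtracted.\<close>
  have "v \<otimes> (inv v \<otimes> u \<ominus> x) \<in> Units R"
    using assms u by (intro Units_m_closed Delta_Units_minus) auto
  also have "v \<otimes> (inv v \<otimes> u \<ominus> x) = v \<otimes> inv v \<otimes> u \<ominus> v \<otimes> x"
    using cl Units_closed[OF u] by algebra
  finally show "u \<ominus> v \<otimes> x \<in> Units R"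
    using assms u by (simp add: Units_closed)
qed

text \<open>The factor \<open>x\<close> is a difference of the units
  \<open>\<one> \<oplus> x\<close> and \<open>\<one>\<close>, and left multiplication by a unit
  preserves \<open>Delta R\<close>.\<close>

lemma Delta_mult:
  assumes "x \<in> Delta R" "y \<in> Delta R"
  shows "x \<otimes> y \<in> Delta R"
proof -
  have "(\<one> \<oplus> x) \<otimes> y \<ominus> y \<in> Delta R"
    using assms by (intro Delta_minus Delta_Units_mult Delta_Units_add) auto
  also have "(\<one> \<oplus> x) \<otimes> y \<ominus> y = x \<otimes> y"
    using assms[THEN Delta_closed] by algebra
  finally show ?thesis .
qed

subsection \<open>Strongly \<open>\<Delta>\<close>-clean rings\<close>

lemma strongly_Delta_clean_one_plus:
  assumes "strongly_Delta_clean R" "x \<in> carrier R" "\<one> \<oplus> x \<in> Units R"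
  shows "x \<in> Delta R"
proof -
  obtain e d where ed: "e \<in> carrier R" "d \<in> Delta R" "\<one> \<oplus> x = e \<oplus> d" "e \<otimes> e = e"
    using assms unfolding strongly_Delta_clean_def by (meson Units_closed)
  note d = Delta_closed[OF ed(2)]
  have "e = (\<one> \<oplus> x) \<ominus> d"
    unfolding ed(3) using ed(1) d by algebra
  then have e: "e \<in> Units R"
    using Delta_Units_minus[OF ed(2) assms(3)] by simp
  \<comment> \<open>Cancelling the unit \<open>e\<close> in
    \<open>e \<otimes> e = e \<otimes> \<one>\<close>.\<close>
  then have "e = \<one>"
    using ed(1,4) Units_l_cancel[of e e \<one>] by simp
  then have "x = d"
    using ed(3) assms(2) d by simp
  then show ?thesis
    using ed(2) by simp
qed

section \<open>Idempotents and Peirce components\<close>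

lemma Units_one_plus_square_zero:
  assumes "x \<in> carrier R" "x \<otimes> x = \<zero>"
  shows "\<one> \<oplus> x \<in> Units R"
proof -
  \<comment> \<open>The geometric series for the inverse stops after
    \<open>\<one> \<ominus> x\<close>.\<close>
  have "(\<one> \<oplus> x) \<otimes> (\<one> \<ominus> x) = \<one> \<ominus> x \<otimes> x" "(\<one> \<ominus> x) \<otimes> (\<one> \<oplus> x) = \<one> \<ominus> x \<otimes> x"
    using assms(1)
    by (simp_all add: minus_eq l_distr r_distr l_minus r_minus a_assoc minus_add r_neg1 r_neg2)
  moreover have "\<one> \<ominus> x \<otimes> x = \<one>"
    unfolding assms(2) by (simp add: minus_eq)
  moreover have "\<one> \<oplus> x \<in> carrier R" "\<one> \<ominus> x \<in> carrier R"
    using assms(1) by simp_all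
  ultimately show ?thesis
    unfolding Units_def by force
qed

text \<open>As \<open>e\<close> commutes with \<open>x\<close>, the element
  \<open>\<one> \<oplus> e \<otimes> x\<close> acts as \<open>\<one> \<oplus> x\<close> on the
  \<open>e\<close> part and as the identity on the complementary part; it is inverted on each part
  separately.\<close>

lemma Units_one_plus_idem_mult:
  assumes e: "e \<in> carrier R" "e \<otimes> e = e"
    and x: "x \<in> carrier R" "e \<otimes> x = x \<otimes> e"
    and unit: "\<one> \<oplus> x \<in> Units R"
  shows "\<one> \<oplus> e \<otimes> x \<in> Units R"
proof -
  define v where "v = inv (\<one> \<oplus> x)"
  have v: "v \<in> carrier R" "(\<one> \<oplus> x) \<otimes> v = \<one>" "v \<otimes> (\<one> \<oplus> x) = \<one>"
    using unit by (auto simp: v_def)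
  have "e \<otimes> (\<one> \<oplus> x) = (\<one> \<oplus> x) \<otimes> e"
    using e x by (simp add: l_distr r_distr)
  \<comment> \<open>Sandwiching between two copies of \<open>v\<close> transfers the commutation
    with \<open>e\<close> from \<open>\<one> \<oplus> x\<close> to its inverse.\<close>
  then have "v \<otimes> (e \<otimes> (\<one> \<oplus> x)) \<otimes> v = v \<otimes> ((\<one> \<oplus> x) \<otimes> e) \<otimes> v"
    by simp
  moreover have "v \<otimes> (e \<otimes> (\<one> \<oplus> x)) \<otimes> v = v \<otimes> e \<otimes> ((\<one> \<oplus> x) \<otimes> v)"
    "v \<otimes> ((\<one> \<oplus> x) \<otimes> e) \<otimes> v = (v \<otimes> (\<one> \<oplus> x)) \<otimes> e \<otimes> v"
    using e(1) x(1) v(1) by (simp_all add: m_assoc)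
  ultimately have ve: "v \<otimes> e = e \<otimes> v"
    using v e(1) by simp
  \<comment> \<open>The candidate inverse: \<open>\<one> \<ominus> e\<close> on the complementary
    part, \<open>v\<close> on the \<open>e\<close> part.\<close>
  let ?w = "(\<one> \<ominus> e) \<oplus> e \<otimes> v"
  have "(\<one> \<oplus> e \<otimes> x) \<otimes> ?w
      = \<one> \<ominus> e \<oplus> e \<otimes> x \<ominus> e \<otimes> (x \<otimes> e) \<oplus> e \<otimes> v \<oplus> e \<otimes> (x \<otimes> e) \<otimes> v"
    using e(1) x(1) v(1) by (algebra; simp)
  also have "\<dots> = \<one> \<ominus> e \<oplus> e \<otimes> x \<ominus> e \<otimes> e \<otimes> x \<oplus> e \<otimes> v \<oplus> (e \<otimes> e) \<otimes> x \<otimes> v"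
    unfolding x(2)[symmetric] using e(1) x(1) v(1) by (algebra; simp)
  also have "\<dots> = \<one> \<ominus> e \<oplus> e \<otimes> ((\<one> \<oplus> x) \<otimes> v)"
    unfolding e(2) using e(1) x(1) v(1) by (algebra; simp)
  also have "\<dots> = \<one>"
    unfolding v(2) using e(1) by (simp add: minus_eq a_assoc l_neg)
  finally have 1: "(\<one> \<oplus> e \<otimes> x) \<otimes> ?w = \<one>" .
  have "?w \<otimes> (\<one> \<oplus> e \<otimes> x)
      = \<one> \<ominus> e \<oplus> e \<otimes> x \<ominus> (e \<otimes> e) \<otimes> x \<oplus> e \<otimes> v \<oplus> e \<otimes> (v \<otimes> e) \<otimes> x"
    using e(1) x(1) v(1) by (algebra; simp)
  also have "\<dots> = \<one> \<ominus> e \<oplus> e \<otimes> x \<ominus> (e \<otimes> e) \<otimes> x \<oplus> e \<otimes> v \<oplus> (e \<otimes> e) \<otimes> v \<otimes> x"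
    unfolding ve using e(1) x(1) v(1) by (algebra; simp)
  also have "\<dots> = \<one> \<ominus> e \<oplus> e \<otimes> (v \<otimes> (\<one> \<oplus> x))"
    unfolding e(2) using e(1) x(1) v(1) by (algebra; simp)
  also have "\<dots> = \<one>"
    unfolding v(3) using e(1) by (simp add: minus_eq a_assoc l_neg)
  finally have 2: "?w \<otimes> (\<one> \<oplus> e \<otimes> x) = \<one>" .
  show ?thesis
    using 1 2 e(1) x(1) v(1) unfolding Units_def by (auto intro!: bexI[of _ ?w])
qed

lemma Delta_idem_mult:
  assumes clean: "strongly_Delta_clean R" and dD: "d \<in> Delta R"
    and e: "e \<in> carrier R" "e \<otimes> e = e"
  shows "e \<otimes> d \<in> Delta R"
proof -
  note d = Delta_closed[OF dD]
  define f where "f = \<one> \<ominus> e"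
  have "e \<otimes> (\<one> \<ominus> e) = e \<ominus> e \<otimes> e" "(\<one> \<ominus> e) \<otimes> e = e \<ominus> e \<otimes> e"
    using e(1) by (algebra; simp)+
  then have f: "f \<in> carrier R" "e \<otimes> f = \<zero>" "f \<otimes> e = \<zero>"
    using e by (simp_all add: f_def minus_eq r_neg)
  define p q where "p = e \<otimes> d \<otimes> f" and "q = f \<otimes> d \<otimes> e"
  have pq: "p \<in> carrier R" "q \<in> carrier R"
    using e f d by (auto simp: p_def q_def)
  have "p \<otimes> p = e \<otimes> d \<otimes> (f \<otimes> e) \<otimes> d \<otimes> f" "q \<otimes> q = f \<otimes> d \<otimes> (e \<otimes> f) \<otimes> d \<otimes> e"
    unfolding p_def q_def using e(1) f(1) d by (simp_all add: m_assoc)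
  then have sq: "p \<otimes> p = \<zero>" "q \<otimes> q = \<zero>"
    using e(1) f d by simp_all
  have p_unit: "\<one> \<oplus> p \<in> Units R" and q_unit: "\<one> \<oplus> q \<in> Units R"
    using Units_one_plus_square_zero pq sq by simp_all
  \<comment> \<open>This is the diagonal part \<open>e d e + f d f\<close> of \<open>d\<close>. It
    stays in \<open>Delta R\<close> because \<open>\<one> \<oplus> p\<close> and
    \<open>\<one> \<oplus> q\<close> are units, which puts \<open>p\<close> and \<open>q\<close> in
    \<open>Delta R\<close>.\<close>
  define x where "x = d \<ominus> p \<ominus> q"
  have xD: "x \<in> Delta R"
    unfolding x_def
    using dD pq p_unit q_unit strongly_Delta_clean_one_plus[OF clean] by (intro Delta_minus)
  note x = Delta_closed[OF xD]
  have "e \<otimes> p = (e \<otimes> e) \<otimes> d \<otimes> f" "e \<otimes> q = (e \<otimes> f) \<otimes> d \<otimes> e"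
    "p \<otimes> e = e \<otimes> d \<otimes> (f \<otimes> e)" "q \<otimes> e = f \<otimes> d \<otimes> (e \<otimes> e)"
    unfolding p_def q_def using e(1) f(1) d by (simp_all add: m_assoc)
  then have epq: "e \<otimes> p = p" "e \<otimes> q = \<zero>" "p \<otimes> e = \<zero>" "q \<otimes> e = q"
    using e f d by (simp_all add: p_def q_def)
  have "e \<otimes> x = e \<otimes> d \<ominus> e \<otimes> p \<ominus> e \<otimes> q" "x \<otimes> e = d \<otimes> e \<ominus> p \<otimes> e \<ominus> q \<otimes> e"
    unfolding x_def using e(1) d pq by (algebra; simp)+
  then have "e \<otimes> x = e \<otimes> d \<ominus> p" "x \<otimes> e = d \<otimes> e \<ominus> q"
    unfolding epq using e(1) d pq by (simp_all add: minus_eq)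
  \<comment> \<open>Both \<open>e \<otimes> x\<close> and \<open>x \<otimes> e\<close> reduce to the
    corner \<open>e d e\<close>, so \<open>x\<close> commutes with \<open>e\<close>.\<close>
  moreover have "e \<otimes> d \<ominus> p = e \<otimes> d \<otimes> e" "d \<otimes> e \<ominus> q = e \<otimes> d \<otimes> e"
    unfolding p_def q_def f_def using e(1) d by (algebra; simp)+
  moreover have "e \<otimes> d = (e \<otimes> d \<ominus> p) \<oplus> p"
    using e(1) d pq by (simp add: minus_eq a_assoc l_neg)
  ultimately have ex: "e \<otimes> x = x \<otimes> e" "e \<otimes> d = e \<otimes> x \<oplus> p"
    by simp_all
  have ex_unit: "\<one> \<oplus> e \<otimes> x \<in> Units R"
    using Units_one_plus_idem_mult e x ex(1) Delta_Units_add[OF xD] by simp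
  have "p \<otimes> (e \<otimes> x) = (p \<otimes> e) \<otimes> x"
    using e(1) x pq by (simp add: m_assoc)
  then have "p \<otimes> (e \<otimes> x) = \<zero>"
    using epq(3) x by simp
  \<comment> \<open>The cross term vanishes because \<open>p\<close> ends in \<open>f\<close>, so
    the product of these two units is exactly \<open>\<one> \<oplus> e \<otimes> d\<close>.\<close>
  moreover have "(\<one> \<oplus> p) \<otimes> (\<one> \<oplus> e \<otimes> x) = \<one> \<oplus> (e \<otimes> x \<oplus> p) \<oplus> p \<otimes> (e \<otimes> x)"
    using e(1) x pq by (algebra; simp)
  ultimately have "(\<one> \<oplus> p) \<otimes> (\<one> \<oplus> e \<otimes> x) = \<one> \<oplus> e \<otimes> d"
    using ex(2) e(1) x pq(1) by simp
  then have "\<one> \<oplus> e \<otimes> d \<in> Units R"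
    using Units_m_closed[OF p_unit ex_unit] by simp
  then show ?thesis
    using strongly_Delta_clean_one_plus[OF clean] e(1) d by simp
qed

lemma Delta_subset_jacobson_radical:
  assumes clean: "strongly_Delta_clean R"
  shows "Delta R \<subseteq> jacobson_radical R"
proof
  fix x assume xD: "x \<in> Delta R"
  note x = Delta_closed[OF xD]
  show "x \<in> jacobson_radical R"
  proof (rule jacobson_radicalI[OF x])
    fix r assume "r \<in> carrier R"
    then obtain e d where ed: "e \<in> carrier R" "d \<in> Delta R" "r = e \<oplus> d" "e \<otimes> e = e"
      using clean unfolding strongly_Delta_clean_def by meson
    \<comment> \<open>Splitting the arbitrary multiplier \<open>r\<close> as
      \<open>e \<oplus> d\<close> leaves one multiple by an idempotent and one product within
      \<open>Delta R\<close>.\<close>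
    have "e \<otimes> x \<oplus> d \<otimes> x \<in> Delta R"
      using ed xD by (intro Delta_add Delta_mult Delta_idem_mult[OF clean])
    then have "r \<otimes> x \<in> Delta R"
      using ed x Delta_closed by (simp add: l_distr)
    then show "\<one> \<ominus> r \<otimes> x \<in> Units R"
      by (simp add: Delta_Units_minus)
  qed
qed

lemma boolean_strongly_Delta_clean:
  assumes "boolean R"
  shows "strongly_Delta_clean R"
  unfolding strongly_Delta_clean_def
proof
  fix a assume a: "a \<in> carrier R"
  then show "\<exists>e\<in>carrier R. \<exists>d\<in>Delta R. a = e \<oplus> d \<and> e \<otimes> e = e \<and> e \<otimes> d = d \<otimes> e"
    \<comment> \<open>Every element is itself idempotent, so \<open>a = a \<oplus> \<zero>\<close>
      is the decomposition.\<close>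
    using assms zero_in_Delta by (intro bexI[of _ a] bexI[of _ \<zero>]) (auto simp: boolean_def)
qed

end

theorem theorem3p7:
  fixes R :: "('a, 'b) ring_scheme" (structure)
  assumes "ring R"
  shows "strongly_Delta_clean R \<and> jacobson_radical R = {\<zero>} \<longleftrightarrow> boolean R"
proof -
  interpret ring R
    by fact
  have "boolean R" if clean: "strongly_Delta_clean R" and J: "jacobson_radical R = {\<zero>}"
    unfolding boolean_def
  proof
    fix a assume "a \<in> carrier R"
    then obtain e d where ed: "e \<in> carrier R" "d \<in> Delta R" "a = e \<oplus> d" "e \<otimes> e = e"
      using clean unfolding strongly_Delta_clean_def by meson
    then have "d = \<zero>"
      using Delta_subset_jacobson_radical[OF clean] J by blast
    then show "a \<otimes> a = a"
      using ed by simp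
  qed
  then show ?thesis
    using boolean_strongly_Delta_clean boolean_jacobson_radical by blast
qed

end
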